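(* Let $d\ge 3$ and $n\ge 3$ be natural numbers. For real $c\neq 0$, the rational map $$f_c(z)=\frac{(d-1)c^d-(d-1)z^d}{(d-1)c^d-dz^{d-1}}$$ is the Newton map of the degree $d$ polynomial $$p_c(z)=z^d-(d-1)c^dz+(d-1)c^d.$$ Moreover, if $c=c_{n-1}$, then $f_c=N_{p_c}$ has a super-attracting $n$-cycle $\{0,1,z_3,\dots,z_n\}$ of $n$ distinct points with $z_n=c$, where $z_i=f_c^{\,i-1}(0)$ for $1\le i\le n$.
   Context: For a complex polynomial $p$, the Newton map is $N_p(z)=z-\frac{p(z)}{p'(z)}$. For a rational map $N$, distinct points $z_1,\dots,z_n$ form an $n$-cycle if $N(z_i)=z_{i+1}$ for $1\le i\le n$, where $z_{n+1}:=z_1$; the cycle is super-attracting if its multiplier $\prod_{i=1}^n N'(z_i)$ equals $0$. $f_c^{\,k}$ denotes the $k$-th iterate of $f_c$ ($f_c^{\,0}$ is the identity). For fixed $d\ge 3$ define real rational functions $Q_k$ of a real variable $c$ by $Q_1\equiv 1$ and $$Q_{i+1}(c)=\frac{c^d-Q_i(c)^d}{c^d-\left(\frac{d}{d-1}\right)Q_i(c)^{d-1}},\qquad i\ge 1$$ (so that $Q_k(c)=f_c^{\,k}(0)$ for $c\ne 0$, and $Q_k(0)=\left(\frac{d-1}{d}\right)^{k-1}$). For $k\ge 1$, $c_k$ denotes the smallest positive solution $y$ of $y^d-Q_k(y)^d=0$ (it exists). *)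

theory Defs
  imports "HOL-Analysis.Analysis"
    "HOL-Computational_Algebra.Computational_Algebra"
    "HOL-Computational_Algebra.Field_as_Ring"
begin

text \<open>
  A rational function over a field is an element of the fraction field of its polynomial ring.
  It is evaluated through its representation in lowest terms, so removable singularities are
  removed; \<open>rat_eval\<close> is meaningful only at points satisfying \<open>rat_finite\<close>,
  i.e. at points that are not poles.
\<close>

definition rat_finite :: "'a::field_gcd poly fract \<Rightarrow> 'a \<Rightarrow> bool" where
  "rat_finite R z \<longleftrightarrow> poly (snd (quot_of_fract R)) z \<noteq> 0"

definition rat_eval :: "'a::field_gcd poly fract \<Rightarrow> 'a \<Rightarrow> 'a" where
  "rat_eval R z = poly (fst (quot_of_fract R)) z / poly (snd (quot_of_fract R)) z"

definition newton_map :: "complex poly \<Rightarrow> complex poly fract" where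
  "newton_map p = to_fract [:0, 1:] - Fract p (pderiv p)"

definition is_cycle :: "complex poly fract \<Rightarrow> nat \<Rightarrow> (nat \<Rightarrow> complex) \<Rightarrow> bool" where
  "is_cycle N n z \<longleftrightarrow> n \<ge> 1 \<and> inj_on z {1..n} \<and>
     (\<forall>i\<in>{1..n}. rat_finite N (z i) \<and> rat_eval N (z i) = z (if i = n then 1 else i + 1))"

definition multiplier :: "complex poly fract \<Rightarrow> nat \<Rightarrow> (nat \<Rightarrow> complex) \<Rightarrow> complex" where
  "multiplier N n z = (\<Prod>i=1..n. deriv (rat_eval N) (z i))"

definition super_attracting_cycle ::
  "complex poly fract \<Rightarrow> nat \<Rightarrow> (nat \<Rightarrow> complex) \<Rightarrow> bool" where
  "super_attracting_cycle N n z \<longleftrightarrow> is_cycle N n z \<and> multiplier N n z = 0"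

definition p_poly :: "nat \<Rightarrow> real \<Rightarrow> complex poly" where
  "p_poly d c = monom 1 d
     - smult ((of_nat d - 1) * of_real c ^ d) [:0, 1:]
     + [:(of_nat d - 1) * of_real c ^ d:]"

definition f_rat :: "nat \<Rightarrow> real \<Rightarrow> complex poly fract" where
  "f_rat d c = Fract
     ([:(of_nat d - 1) * of_real c ^ d:] - monom (of_nat d - 1) d)
     ([:(of_nat d - 1) * of_real c ^ d:] - monom (of_nat d) (d - 1))"

text \<open>
  The rational functions \<open>Q_rat d k\<close>, for \<open>k \<ge> 1\<close>, in the variable \<open>c\<close>, which is
  \<^term>\<open>to_fract [:0, 1:]\<close>. The value at \<open>k = 0\<close> is a dummy.
\<close>

fun Q_rat :: "nat \<Rightarrow> nat \<Rightarrow> real poly fract" where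
  "Q_rat d 0 = 0"
| "Q_rat d (Suc 0) = 1"
| "Q_rat d (Suc (Suc i)) =
     (to_fract [:0, 1:] ^ d - Q_rat d (Suc i) ^ d) /
     (to_fract [:0, 1:] ^ d - to_fract [:real d / (real d - 1):] * Q_rat d (Suc i) ^ (d - 1))"

definition c_root :: "nat \<Rightarrow> nat \<Rightarrow> real" where
  "c_root d k = (LEAST y. y > 0 \<and> rat_finite (Q_rat d k) y \<and> y ^ d - rat_eval (Q_rat d k) y ^ d = 0)"

end

theory Submission
  imports Defs
begin

text \<open>
  The identity \<open>f = N\<^sub>p\<close> is the computation
  \<open>z p'(z) - p(z) = (d - 1) z^d - (d - 1) c^d\<close>. In this form \<open>c\<close> is visibly a
  zero of the numerator of \<open>f\<close>, so \<open>c\<close> is mapped to \<open>0\<close> unless it is a pole,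
  and \<open>0\<close> is mapped to \<open>1\<close>. So the orbit of \<open>0\<close> closes up as soon as it hits
  \<open>c\<close>, and since \<open>f\<close> agrees with the recursion for \<open>Q\<close>, the orbit is
  \<open>0, Q\<^sub>1(c), Q\<^sub>2(c), \<dots>\<close>. The cycle is super-attracting because
  \<open>N\<^sub>p' = p p'' / p'^2\<close> vanishes at \<open>0\<close> when \<open>d \<ge> 3\<close>.

  The substance lies in the roots \<open>c\<^sub>k\<close>. The key invariant is that, on the interval
  \<open>[0, c\<^sub>k]\<close>, the function \<open>Q\<^sub>k\<close> has no pole and its graph stays above the
  diagonal until it first meets it, at \<open>c\<^sub>k \<le> 1\<close>
  (\<open>c_root_first_crossing\<close>). It is inherited by \<open>Q\<^sub>k\<^sub>+\<^sub>1\<close>: as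
  \<open>0 \<le> y \<le> Q\<^sub>k(y)\<close> and \<open>y \<le> 1\<close> there, the denominator
  \<open>y^d - d/(d - 1) Q\<^sub>k(y)^(d - 1)\<close> is negative, so \<open>Q\<^sub>k\<^sub>+\<^sub>1\<close> is continuous
  on \<open>[0, c\<^sub>k]\<close>; it is positive at \<open>0\<close> and vanishes at \<open>c\<^sub>k\<close>. Hence it
  crosses the diagonal for the first time strictly before \<open>c\<^sub>k\<close>.

  Consequently \<open>c\<^sub>1 > c\<^sub>2 > \<dots>\<close>, and for \<open>c = c\<^sub>n\<^sub>-\<^sub>1\<close> all of
  \<open>Q\<^sub>1(c), \<dots>, Q\<^sub>n\<^sub>-\<^sub>2(c)\<close> are larger than \<open>c\<close> while
  \<open>Q\<^sub>n\<^sub>-\<^sub>1(c) = c\<close>. So \<open>c\<close> is reached at the index \<open>n\<close> and at no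
  earlier one. This makes the points distinct: if two of them coincided, the orbit would be
  periodic with a smaller period and \<open>c\<close> would be reached too early.
\<close>

section \<open>Evaluating rational functions\<close>

text \<open>
  Evaluation is defined through lowest terms, but any representation whose denominator does not
  vanish at the point gives the same value: by the cross-multiplied identity, a zero of the reduced
  denominator would be a zero of the reduced numerator too, contradicting coprimality. This makes
  evaluation compatible with the field operations.
\<close>

lemma rat_Fract:
  fixes a b :: "'a::field_gcd poly"
  assumes "poly b x \<noteq> 0"
  shows "rat_finite (Fract a b) x" and "rat_eval (Fract a b) x = poly a x / poly b x"
proof -
  define u v where "u = fst (quot_of_fract (Fract a b))" and "v = snd (quot_of_fract (Fract a b))"
  have "b \<noteq> 0" using assms by auto
  have "v \<noteq> 0" unfolding v_def by simp
  have "Fract u v = Fract a b" unfolding u_def v_def by (rule Fract_quot_of_fract)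
  then have "u * b = a * v" using \<open>b \<noteq> 0\<close> \<open>v \<noteq> 0\<close> by (simp add: eq_fract)
  then have cross: "poly u x * poly b x = poly a x * poly v x" by (metis poly_mult)
  have "coprime u v" unfolding u_def v_def by (rule coprime_quot_of_fract)
  have v: "poly v x \<noteq> 0"
  proof
    assume "poly v x = 0"
    with cross assms have "poly u x = 0" by simp
    with \<open>poly v x = 0\<close> have "[:-x, 1:] dvd u" "[:-x, 1:] dvd v"
      by (simp_all add: poly_eq_0_iff_dvd)
    with \<open>coprime u v\<close> have "is_unit [:-x, 1:]" using coprime_common_divisor by blast
    then show False by (auto simp: is_unit_poly_iff)
  qed
  then show "rat_finite (Fract a b) x" by (simp add: rat_finite_def v_def)
  show "rat_eval (Fract a b) x = poly a x / poly b x"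
    using cross v assms by (simp add: rat_eval_def flip: u_def v_def) (simp add: field_simps)
qed

lemma rat_finiteE:
  fixes R :: "'a::field_gcd poly fract"
  assumes "rat_finite R x"
  obtains a b where "R = Fract a b" and "poly b x \<noteq> 0" and "rat_eval R x = poly a x / poly b x"
  using assms that[of "fst (quot_of_fract R)" "snd (quot_of_fract R)"]
  by (simp add: rat_finite_def rat_eval_def Fract_quot_of_fract)

lemma rat_to_fract:
  fixes a :: "'a::field_gcd poly"
  shows "rat_finite (to_fract a) x" and "rat_eval (to_fract a) x = poly a x"
  using rat_Fract[of 1 x a] by (simp_all add: to_fract_def)

lemma rat_diff:
  fixes R S :: "'a::field_gcd poly fract"
  assumes "rat_finite R x" and "rat_finite S x"
  shows "rat_finite (R - S) x" and "rat_eval (R - S) x = rat_eval R x - rat_eval S x"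
proof -
  obtain a b where R: "R = Fract a b" "poly b x \<noteq> 0" "rat_eval R x = poly a x / poly b x"
    using assms(1) by (rule rat_finiteE)
  obtain u v where S: "S = Fract u v" "poly v x \<noteq> 0" "rat_eval S x = poly u x / poly v x"
    using assms(2) by (rule rat_finiteE)
  have "b \<noteq> 0" "v \<noteq> 0" using R S by auto
  then have "R - S = Fract (a * v - u * b) (b * v)" using R S by simp
  moreover have "poly (b * v) x \<noteq> 0" using R S by simp
  ultimately show "rat_finite (R - S) x" "rat_eval (R - S) x = rat_eval R x - rat_eval S x"
    using R(2,3) S(2,3) by (simp_all add: rat_Fract diff_frac_eq)
qed

lemma rat_mult:
  fixes R S :: "'a::field_gcd poly fract"
  assumes "rat_finite R x" and "rat_finite S x"
  shows "rat_finite (R * S) x" and "rat_eval (R * S) x = rat_eval R x * rat_eval S x"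
proof -
  obtain a b where R: "R = Fract a b" "poly b x \<noteq> 0" "rat_eval R x = poly a x / poly b x"
    using assms(1) by (rule rat_finiteE)
  obtain u v where S: "S = Fract u v" "poly v x \<noteq> 0" "rat_eval S x = poly u x / poly v x"
    using assms(2) by (rule rat_finiteE)
  have "R * S = Fract (a * u) (b * v)" using R S by simp
  moreover have "poly (b * v) x \<noteq> 0" using R S by simp
  ultimately show "rat_finite (R * S) x" "rat_eval (R * S) x = rat_eval R x * rat_eval S x"
    using R(2,3) S(2,3) by (simp_all add: rat_Fract)
qed

lemma rat_divide:
  fixes R S :: "'a::field_gcd poly fract"
  assumes "rat_finite R x" and "rat_finite S x" and "rat_eval S x \<noteq> 0"
  shows "rat_finite (R / S) x" and "rat_eval (R / S) x = rat_eval R x / rat_eval S x"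
proof -
  obtain a b where R: "R = Fract a b" "poly b x \<noteq> 0" "rat_eval R x = poly a x / poly b x"
    using assms(1) by (rule rat_finiteE)
  obtain u v where S: "S = Fract u v" "poly v x \<noteq> 0" "rat_eval S x = poly u x / poly v x"
    using assms(2) by (rule rat_finiteE)
  have "R / S = Fract (a * v) (b * u)" using R S by simp
  moreover have "poly (b * u) x \<noteq> 0" using R S assms(3) by auto
  ultimately show "rat_finite (R / S) x" "rat_eval (R / S) x = rat_eval R x / rat_eval S x"
    using R(2,3) S(2,3) by (simp_all add: rat_Fract)
qed

lemma rat_power:
  fixes R :: "'a::field_gcd poly fract"
  assumes "rat_finite R x"
  shows "rat_finite (R ^ m) x \<and> rat_eval (R ^ m) x = rat_eval R x ^ m"
proof (induction m)
  case 0
  show ?case using rat_to_fract[of 1 x] by simp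
next
  case (Suc m)
  then show ?case using rat_mult[OF assms, of "R ^ m"] by simp
qed

lemma continuous_on_rat_eval:
  fixes R :: "real poly fract"
  assumes "\<And>x. x \<in> S \<Longrightarrow> rat_finite R x"
  shows "continuous_on S (rat_eval R)"
  unfolding rat_eval_def[abs_def]
  using assms by (intro continuous_intros) (auto simp: rat_finite_def)


section \<open>The first crossing of the diagonal\<close>

lemma Q_rat_Suc:
  assumes "k \<ge> 1" and fin: "rat_finite (Q_rat d k) x"
    and q: "q = rat_eval (Q_rat d k) x"
    and nz: "x ^ d - real d / (real d - 1) * q ^ (d - 1) \<noteq> 0"
  shows "rat_finite (Q_rat d (Suc k)) x"
    and "rat_eval (Q_rat d (Suc k)) x =
      (x ^ d - q ^ d) / (x ^ d - real d / (real d - 1) * q ^ (d - 1))"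
proof -
  obtain i where k: "k = Suc i" using assms(1) by (cases k) auto
  have X: "rat_finite (to_fract [:0, 1:] ^ m) x" "rat_eval (to_fract [:0, 1:] ^ m) x = x ^ m" for m
    using rat_power[OF rat_to_fract(1)[of "[:0, 1:]" x], of m] by (simp_all add: rat_to_fract)
  have Q: "rat_finite (Q_rat d k ^ m) x" "rat_eval (Q_rat d k ^ m) x = q ^ m" for m
    using rat_power[OF fin, of m] q by auto
  note facts = rat_diff rat_mult X Q rat_to_fract
  show "rat_finite (Q_rat d (Suc k)) x"
    "rat_eval (Q_rat d (Suc k)) x =
      (x ^ d - q ^ d) / (x ^ d - real d / (real d - 1) * q ^ (d - 1))"
    using nz unfolding k Q_rat.simps unfolding k[symmetric]
    by (subst rat_divide; simp add: facts)+
qed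

lemma first_crossing:
  fixes g :: "real \<Rightarrow> real"
  assumes "continuous_on {0..b} g" and "0 \<le> b" and "g 0 > 0" and "g b < b"
  obtains a where "0 < a" and "a < b" and "g a = a" and "\<And>x. 0 \<le> x \<Longrightarrow> x < a \<Longrightarrow> x < g x"
proof -
  define h where "h = (\<lambda>x. g x - x)"
  have cont: "continuous_on {0..b} h" unfolding h_def using assms(1) by (intro continuous_intros)
  define Z where "Z = {x \<in> {0..b}. h x = 0}"
  have zero: "\<exists>y \<in> Z. y \<le> x" if x: "0 \<le> x" "x \<le> b" "h x \<le> 0" for x
  proof -
    have "continuous_on {0..x} h" by (rule continuous_on_subset[OF cont]) (use x in auto)
    then obtain y where "0 \<le> y" "y \<le> x" "h y = 0"
      using IVT2'[of h x 0 0] x assms(3) by (auto simp: h_def)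
    then show ?thesis using x by (auto simp: Z_def)
  qed
  have "compact Z"
    unfolding Z_def using continuous_closed_preimage_constant[OF cont]
    by (simp add: compact_eq_bounded_closed bounded_subset[of "{0..b}"] subset_iff)
  moreover have "Z \<noteq> {}" using zero[of b] assms by (auto simp: h_def)
  ultimately obtain a where a: "a \<in> Z" "\<And>y. y \<in> Z \<Longrightarrow> a \<le> y"
    using compact_attains_inf[of Z] by auto
  show thesis
  proof (rule that)
    show "0 < a" "a < b" "g a = a" using a(1) assms(3,4)
      by (auto simp: Z_def h_def order_less_le)
    show "x < g x" if "0 \<le> x" "x < a" for x
      using zero[of x] a that by (force simp: Z_def h_def)
  qed
qed

text \<open>
  The bound by \<open>1\<close> and the absence of poles are carried along because together they keep the
  recursion for the next function free of poles on the same interval.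
\<close>

definition first_crossing_of :: "nat \<Rightarrow> nat \<Rightarrow> real \<Rightarrow> bool" where
  "first_crossing_of d k b \<longleftrightarrow> 0 < b \<and> b \<le> 1 \<and> (\<forall>x\<in>{0..b}. rat_finite (Q_rat d k) x) \<and>
     rat_eval (Q_rat d k) b = b \<and> (\<forall>x\<in>{0..<b}. x < rat_eval (Q_rat d k) x)"

text \<open>
  The roots are defined by equality of \<open>d\<close>-th powers, which for even \<open>d\<close> also allows
  \<open>Q(y) = - y\<close>. This cannot happen before the first crossing, where \<open>Q(y) > y > 0\<close>.
\<close>

lemma c_root_eqI:
  assumes "d \<ge> 1" and "first_crossing_of d k b"
  shows "c_root d k = b"
  unfolding c_root_def
proof (rule Least_equality)
  show "b > 0 \<and> rat_finite (Q_rat d k) b \<and> b ^ d - rat_eval (Q_rat d k) b ^ d = 0"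
    using assms by (auto simp: first_crossing_of_def)
  fix y assume y: "y > 0 \<and> rat_finite (Q_rat d k) y \<and> y ^ d - rat_eval (Q_rat d k) y ^ d = 0"
  show "b \<le> y"
  proof (rule ccontr)
    assume "\<not> b \<le> y"
    then have "y < rat_eval (Q_rat d k) y" using y assms by (auto simp: first_crossing_of_def)
    then have "y ^ d < rat_eval (Q_rat d k) y ^ d" using y assms(1) by (intro power_strict_mono) auto
    then show False using y by simp
  qed
qed

text \<open>
  The exponent drops by one for free because \<open>x \<le> 1\<close>, and the factor \<open>d / (d - 1)\<close>
  makes the inequality strict even when \<open>x = q\<close>, that is, at the crossing point itself.
\<close>

lemma denominator_neg:
  fixes x q :: real
  assumes "d \<ge> 3" and "0 \<le> x" and "x \<le> 1" and "x \<le> q" and "0 < q"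
  shows "x ^ d < real d / (real d - 1) * q ^ (d - 1)"
proof -
  have "x ^ d \<le> x ^ (d - 1)" using assms by (intro power_decreasing) auto
  also have "\<dots> \<le> q ^ (d - 1)" using assms by (intro power_mono) auto
  also have "\<dots> < real d / (real d - 1) * q ^ (d - 1)" using assms by (simp add: field_simps)
  finally show ?thesis .
qed

lemma Q_rat_on_interval:
  assumes "d \<ge> 3" and "k \<ge> 1" and b: "first_crossing_of d k b" and x: "0 \<le> x" "x \<le> b"
  defines "q \<equiv> rat_eval (Q_rat d k) x"
  shows "rat_finite (Q_rat d (Suc k)) x"
    and "x ^ d < real d / (real d - 1) * q ^ (d - 1)"
    and "rat_eval (Q_rat d (Suc k)) x =
      (x ^ d - q ^ d) / (x ^ d - real d / (real d - 1) * q ^ (d - 1))"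
proof -
  have "x \<le> q" "0 < q" using b x by (cases "x = b"; force simp: first_crossing_of_def q_def)+
  moreover have "x \<le> 1" using b x by (auto simp: first_crossing_of_def)
  ultimately show neg: "x ^ d < real d / (real d - 1) * q ^ (d - 1)"
    using assms(1) x by (intro denominator_neg)
  have "rat_finite (Q_rat d k) x" using b x by (auto simp: first_crossing_of_def)
  then show "rat_finite (Q_rat d (Suc k)) x"
    "rat_eval (Q_rat d (Suc k)) x =
      (x ^ d - q ^ d) / (x ^ d - real d / (real d - 1) * q ^ (d - 1))"
    using Q_rat_Suc[OF assms(2), of d x q] neg by (auto simp: q_def)
qed

text \<open>
  On \<open>[0, b]\<close> the next function is continuous. At \<open>0\<close> the recursion degenerates to
  multiplication by \<open>(d - 1) / d\<close>, so the value stays positive; at \<open>b\<close> the numerator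
  vanishes, so the graph has dropped below the diagonal.
\<close>

lemma first_crossing_Suc:
  assumes "d \<ge> 3" and "k \<ge> 1" and b: "first_crossing_of d k b"
  obtains a where "first_crossing_of d (Suc k) a" and "a < b"
proof -
  define Q where "Q = rat_eval (Q_rat d (Suc k))"
  note interval = Q_rat_on_interval[OF assms]
  have b01: "0 < b" "b \<le> 1" using b by (auto simp: first_crossing_of_def)
  have "Q b = 0"
    using interval(3)[of b] b by (simp add: Q_def first_crossing_of_def)
  have "Q 0 > 0"
  proof -
    have "rat_eval (Q_rat d k) 0 > 0" using b b01 by (auto simp: first_crossing_of_def)
    moreover have "Q 0 = rat_eval (Q_rat d k) 0 ^ d /
        (real d / (real d - 1) * rat_eval (Q_rat d k) 0 ^ (d - 1))"
      using interval(3)[of 0] b01 assms(1) by (simp add: Q_def zero_power)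
    ultimately show ?thesis using assms(1) by simp
  qed
  have "continuous_on {0..b} Q"
    unfolding Q_def by (rule continuous_on_rat_eval) (use interval(1) in auto)
  then obtain a where a: "0 < a" "a < b" "Q a = a" "\<And>x. 0 \<le> x \<Longrightarrow> x < a \<Longrightarrow> x < Q x"
    using first_crossing[of b Q] \<open>Q 0 > 0\<close> \<open>Q b = 0\<close> b01 by auto
  have "first_crossing_of d (Suc k) a"
    using a b01 interval(1) by (auto simp: first_crossing_of_def Q_def)
  then show thesis using a(2) that by blast
qed

lemma c_root_first_crossing:
  assumes "d \<ge> 3" and "k \<ge> 1"
  shows "first_crossing_of d k (c_root d k)"
  using assms(2)
proof (induction k rule: dec_induct)
  case base
  have "first_crossing_of d 1 1"
    using rat_to_fract[of "1::real poly"] by (auto simp: first_crossing_of_def)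
  then show ?case using c_root_eqI[of d 1 1] assms(1) by simp
next
  case (step k)
  obtain a where "first_crossing_of d (Suc k) a"
    using first_crossing_Suc[OF assms(1) _ step.IH] step.hyps by blast
  then show ?case using c_root_eqI[of d "Suc k" a] assms(1) by simp
qed

lemma c_root_Suc_less:
  assumes "d \<ge> 3" and "k \<ge> 1"
  shows "c_root d (Suc k) < c_root d k"
  using first_crossing_Suc[OF assms c_root_first_crossing[OF assms]] c_root_eqI[of d "Suc k"] assms(1)
  by (metis numeral_One order_trans one_le_numeral)

lemma c_root_less:
  assumes "d \<ge> 3" and "1 \<le> i" and "i < k"
  shows "c_root d k < c_root d i"
  using assms(3)
proof (induction k rule: less_induct)
  case (less k)
  then obtain j where k: "k = Suc j" "i \<le> j" by (cases k) auto
  have "c_root d k < c_root d j" using c_root_Suc_less[of d j] assms k by simp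
  moreover have "c_root d j \<le> c_root d i" using less.IH[of j] k by (cases "i = j") auto
  ultimately show ?case by simp
qed


section \<open>The Newton map\<close>

lemma degree_p_poly:
  assumes "d \<ge> 3"
  shows "degree (p_poly d c) = d"
proof -
  define A where "A = (of_nat d - 1) * (of_real c :: complex) ^ d"
  have eq: "p_poly d c = monom 1 d + [:A, - A:]" by (simp add: p_poly_def A_def)
  have "degree [:A, - A:] < d" using assms degree_pCons_le[of A "[:-A:]"] by simp
  then show ?thesis unfolding eq by (subst degree_add_eq_left) (simp_all add: degree_monom_eq)
qed

lemma f_rat_newton_map:
  assumes "d \<ge> 3"
  shows "f_rat d c = newton_map (p_poly d c)"
proof -
  define A where "A = (of_nat d - 1) * (of_real c :: complex) ^ d"
  define p where "p = p_poly d c"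
  define a where "a = [:A:] - monom (of_nat d - 1) d"
  define b where "b = [:A:] - monom (of_nat d) (d - 1)"
  have p: "p = monom 1 d - smult A [:0, 1:] + [:A:]" by (simp add: p_def p_poly_def A_def)
  have p': "pderiv p = - b"
    unfolding p b_def by (simp add: pderiv_add pderiv_diff pderiv_monom pderiv_smult pderiv_pCons)
  have X: "[:0, 1:] * monom (of_nat d :: complex) (d - 1) = monom (of_nat d) d"
    using assms by (cases d) (simp_all add: monom_Suc)
  have num: "[:0, 1:] * pderiv p - p = - a"
    unfolding p' unfolding p a_def b_def right_diff_distrib minus_diff_eq X
    by (simp add: diff_monom[symmetric])
  have "coeff b (d - 1) \<noteq> 0" using assms by (simp add: b_def coeff_pCons split: nat.splits)
  then have "b \<noteq> 0" by auto
  have "newton_map p = Fract ([:0, 1:] * pderiv p - p) (pderiv p)"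
    using \<open>b \<noteq> 0\<close> p' by (simp add: newton_map_def to_fract_def)
  also have "\<dots> = Fract a b" unfolding num unfolding p' by simp
  also have "\<dots> = f_rat d c" by (simp add: f_rat_def a_def b_def A_def)
  finally show ?thesis by (simp add: p_def)
qed

lemma f_rat_eval:
  fixes z :: complex
  assumes "(of_nat d - 1) * of_real c ^ d - of_nat d * z ^ (d - 1) \<noteq> 0"
  shows "rat_finite (f_rat d c) z"
    and "rat_eval (f_rat d c) z =
      ((of_nat d - 1) * of_real c ^ d - (of_nat d - 1) * z ^ d) /
      ((of_nat d - 1) * of_real c ^ d - of_nat d * z ^ (d - 1))"
  unfolding f_rat_def using assms
  by (subst rat_Fract; simp add: poly_monom)+

text \<open>
  Dividing numerator and denominator by \<open>d - 1\<close> brings the map into the shape of the recursion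
  for the rational functions \<open>Q\<close>.
\<close>

lemma f_rat_eval_real:
  fixes q :: real
  assumes "d \<ge> 3" and "c ^ d - real d / (real d - 1) * q ^ (d - 1) \<noteq> 0"
  shows "rat_finite (f_rat d c) (of_real q)"
    and "rat_eval (f_rat d c) (of_real q) =
      of_real ((c ^ d - q ^ d) / (c ^ d - real d / (real d - 1) * q ^ (d - 1)))"
proof -
  have d: "real d - 1 > 0" using assms(1) by simp
  define D where "D = (real d - 1) * c ^ d - real d * q ^ (d - 1)"
  have D: "D = (real d - 1) * (c ^ d - real d / (real d - 1) * q ^ (d - 1))"
    using d by (simp add: D_def field_simps)
  have DC: "(of_nat d - 1) * of_real c ^ d - of_nat d * (of_real q :: complex) ^ (d - 1) = of_real D"
    by (simp add: D_def)
  have "D \<noteq> 0" using D d assms(2) by simp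
  then have nz: "(of_nat d - 1) * of_real c ^ d - of_nat d * (of_real q :: complex) ^ (d - 1) \<noteq> 0"
    unfolding DC by simp
  show "rat_finite (f_rat d c) (of_real q)" by (rule f_rat_eval(1)[OF nz])
  have "rat_eval (f_rat d c) (of_real q) = of_real (((real d - 1) * (c ^ d - q ^ d)) / D)"
    unfolding f_rat_eval(2)[OF nz] DC by (simp add: algebra_simps)
  also have "((real d - 1) * (c ^ d - q ^ d)) / D =
      (c ^ d - q ^ d) / (c ^ d - real d / (real d - 1) * q ^ (d - 1))"
    unfolding D using d by simp
  finally show "rat_eval (f_rat d c) (of_real q) =
      of_real ((c ^ d - q ^ d) / (c ^ d - real d / (real d - 1) * q ^ (d - 1)))" .
qed

text \<open>
  Numerator and denominator are constants plus powers of \<open>z\<close> with exponents \<open>d\<close> and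
  \<open>d - 1 \<ge> 2\<close>, so both have derivative zero at the origin.
\<close>

lemma deriv_f_rat_0:
  assumes "d \<ge> 3" and "c \<noteq> 0"
  shows "deriv (rat_eval (f_rat d c)) 0 = 0"
proof -
  define A where "A = (of_nat d - 1) * (of_real c :: complex) ^ d"
  have "of_nat d \<noteq> (1 :: complex)" using assms(1) by (simp add: of_nat_eq_1_iff)
  then have "A \<noteq> 0" using assms(2) by (simp add: A_def)
  define g where "g = (\<lambda>z. (A - (of_nat d - 1) * z ^ d) / (A - of_nat d * z ^ (d - 1)))"
  have "((\<lambda>z. A - of_nat d * z ^ (d - 1)) \<longlongrightarrow> A - of_nat d * 0 ^ (d - 1)) (nhds 0)"
    by (intro tendsto_intros filterlim_ident)
  then have "((\<lambda>z. A - of_nat d * z ^ (d - 1)) \<longlongrightarrow> A) (nhds 0)"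
    using assms(1) by (simp add: zero_power)
  then have "eventually (\<lambda>z. A - of_nat d * z ^ (d - 1) \<noteq> 0) (nhds 0)"
    using \<open>A \<noteq> 0\<close> by (rule tendsto_imp_eventually_ne)
  then have ev: "eventually (\<lambda>z. rat_eval (f_rat d c) z = g z) (nhds 0)"
    by eventually_elim (simp add: f_rat_eval g_def A_def)
  have "(g has_field_derivative 0) (at 0)"
    unfolding g_def using assms(1) \<open>A \<noteq> 0\<close>
    by (auto intro!: derivative_eq_intros simp: zero_power)
  then show ?thesis using deriv_cong_ev[OF ev refl] by (simp add: DERIV_imp_deriv)
qed


section \<open>The cycle\<close>

theorem mainTheorem5:
  fixes d n :: nat and c :: real and z :: "nat \<Rightarrow> complex"
  assumes "d \<ge> 3" and "n \<ge> 3" and "c \<noteq> 0"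
  defines "z \<equiv> (\<lambda>i. (rat_eval (f_rat d c) ^^ (i - 1)) 0)"
  shows "degree (p_poly d c) = d \<and>
    f_rat d c = newton_map (p_poly d c) \<and>
    (c = c_root d (n - 1) \<longrightarrow>
       super_attracting_cycle (newton_map (p_poly d c)) n z \<and>
       z 1 = 0 \<and> z 2 = 1 \<and> z n = of_real c)"
proof (intro conjI impI)
  show "degree (p_poly d c) = d" using assms(1) by (rule degree_p_poly)
  show newton: "f_rat d c = newton_map (p_poly d c)" using assms(1) by (rule f_rat_newton_map)
  assume c: "c = c_root d (n - 1)"
  define f where "f = rat_eval (f_rat d c)"
  define q where "q = (\<lambda>i. rat_eval (Q_rat d i) c)"
  have z_Suc: "z (Suc i) = f (z i)" if "i \<ge> 1" for i
    using that by (cases i) (simp_all add: z_def f_def)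
  have crossing: "first_crossing_of d i (c_root d i)" if "i \<ge> 1" for i
    using that assms(1) by (intro c_root_first_crossing)
  have "c > 0" using crossing[of "n - 1"] assms(2) c by (simp add: first_crossing_of_def)
  have c_le: "c \<le> c_root d i" if "1 \<le> i" "i < n" for i
  proof (cases "i = n - 1")
    case False
    then have "i < n - 1" using that by linarith
    then show ?thesis using c_root_less[of d i "n - 1"] that(1) assms(1) c by simp
  qed (simp add: c)
  have q_last: "q (n - 1) = c"
    using crossing[of "n - 1"] assms(2) c by (simp add: first_crossing_of_def q_def)
  have q_gt: "c < q i" if "1 \<le> i" "i < n - 1" for i
    using crossing[of i] c_root_less[of d i "n - 1"] that assms(1) c \<open>c > 0\<close>
    by (auto simp: first_crossing_of_def q_def)
  have denom: "c ^ d - real d / (real d - 1) * q i ^ (d - 1) \<noteq> 0" if "1 \<le> i" "i < n" for i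
    using Q_rat_on_interval(2)[OF assms(1) that(1) crossing less_imp_le[OF \<open>c > 0\<close>] c_le] that \<open>c > 0\<close>
    by (simp add: q_def)
  have f_q: "f (of_real (q i)) = of_real ((c ^ d - q i ^ d) /
      (c ^ d - real d / (real d - 1) * q i ^ (d - 1)))" if "1 \<le> i" "i < n" for i
    using f_rat_eval_real(2)[OF assms(1) denom[OF that]] by (simp add: f_def)
  have d0: "real d - 1 \<noteq> 0" using assms(1) by simp
  have zero: "rat_finite (f_rat d c) 0" "f 0 = 1"
    using f_rat_eval_real[of d c 0] assms(1,3) by (auto simp: f_def zero_power)
  have z1: "z 1 = 0" by (simp add: z_def)
  have z_q: "z (Suc i) = of_real (q i)" if "1 \<le> i" "i < n" for i
    using that
  proof (induction i rule: dec_induct)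
    case base
    have "z (Suc 1) = 1" using z_Suc[of 1] z1 zero(2) by simp
    moreover have "q 1 = 1" using rat_to_fract[of "1::real poly" c] by (simp add: q_def)
    ultimately show ?case by simp
  next
    case (step i)
    have "z (Suc (Suc i)) = f (of_real (q i))" using step z_Suc[of "Suc i"] by simp
    also have "\<dots> = of_real (q (Suc i))"
      using Q_rat_on_interval(3)[OF assms(1) step(1) crossing less_imp_le[OF \<open>c > 0\<close>] c_le] step \<open>c > 0\<close> f_q[of i]
      by (simp add: q_def)
    finally show ?case .
  qed
  have zn: "z n = of_real c" using z_q[of "n - 1"] q_last assms(2) by simp
  have fc: "f (of_real c) = 0" using f_q[of "n - 1"] q_last assms(2) by simp
  have ne_c: "z i \<noteq> of_real c" if i: "1 \<le> i" "i < n" for i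
  proof (cases "i = 1")
    case False
    then obtain j where "i = Suc j" "1 \<le> j" using i by (cases i) auto
    then have "j < n - 1" using i by linarith
    then have "c < q j" using \<open>1 \<le> j\<close> by (rule q_gt[rotated])
    then show ?thesis using i \<open>i = Suc j\<close> \<open>1 \<le> j\<close> z_q[of j] by simp
  qed (use z1 assms(3) in simp)
  have shift: "z (i + m) = (f ^^ m) (z i)" if "i \<ge> 1" for i m
    using that by (induction m) (simp_all add: z_Suc)
  have ne: "z i \<noteq> z j" if "1 \<le> i" "i < j" "j \<le> n" for i j
  proof
    assume "z i = z j"
    have "1 \<le> j" using that by simp
    \<comment> \<open>Iterating until the later point reaches \<open>z n\<close> brings the earlier one to \<open>c\<close> too soon.\<close>
    have "z (i + (n - j)) = z (j + (n - j))"
      using shift[OF that(1)] shift[OF \<open>1 \<le> j\<close>] \<open>z i = z j\<close> by (simp only:)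
    also have "\<dots> = of_real c" using that zn by simp
    finally have "z (i + (n - j)) = of_real c" .
    moreover have "1 \<le> i + (n - j)" "i + (n - j) < n" using that by linarith+
    ultimately show False using ne_c by blast
  qed
  have "inj_on z {1..n}"
    by (rule linorder_inj_onI) (use ne in auto)
  moreover have "rat_finite (f_rat d c) (z i)" if i: "i \<in> {1..n}" for i
  proof (cases "i = 1")
    case False
    then obtain j where "i = Suc j" "1 \<le> j" using i by (cases i) auto
    then show ?thesis using i z_q[of j] f_rat_eval_real(1)[OF assms(1) denom[of j]] by simp
  qed (use z1 zero(1) in simp)
  moreover have "f (z i) = z (if i = n then 1 else i + 1)" if "i \<in> {1..n}" for i
    using that zn fc z1 z_Suc[of i] by auto
  ultimately have "is_cycle (f_rat d c) n z" using assms(2) by (auto simp: is_cycle_def f_def)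
  moreover have "multiplier (f_rat d c) n z = 0"
    unfolding multiplier_def using assms(1-3) deriv_f_rat_0[of d c] z1
    by (intro prod_zero bexI[of _ 1]) auto
  ultimately show "super_attracting_cycle (newton_map (p_poly d c)) n z"
    by (simp add: super_attracting_cycle_def newton)
  show "z 1 = 0" by (rule z1)
  show "z 2 = 1" using z_Suc[of 1] z1 zero(2) by (simp add: numeral_2_eq_2)
  show "z n = of_real c" by (rule zn)
qed

end
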